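(* Let $\Lambda\subset\mathbb R^d$ be a Bravais lattice and let $G=(\{1,2\},E,K,1,2)$ be the two-terminal weighted multigraph with node set $V=\{1,2\}$, source $1$, sink $2$, and $E$ a nonempty finite set of edges connecting $1$ and $2$, with kernels $K_e\in\ell^1(\Lambda)$. Then the graph lattice sum is $$\mathcal Z_G(\boldsymbol k)=\mathcal F_\Lambda\Big(\prod_{e\in E}\tilde K_e\Big)(\boldsymbol k),\qquad \boldsymbol k\in\mathrm{BZ},$$ where $\tilde K_e=K_e$ if $(e^-,e^+)=(1,2)$ and $\tilde K_e=K_e(-\,\cdot\,)$ if $(e^-,e^+)=(2,1)$. In the case of single power-law kernels $K_e=\mathcal K_{\nu_e}$ with $\mathrm{Re}(\nu_e)>d$ for all $e\in E$, in which case the graph lattice sum is denoted $\zeta_G$, one obtains $$\zeta_G(\boldsymbol k)=Z_{\Lambda,\mu}(\boldsymbol k),\qquad \mu=\sum_{e\in E}\nu_e.$$ The case of equal terminals $s=t$ (no momentum dependence) is obtained by setting $\boldsymbol k=\boldsymbol 0$ in these formulas.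
   Context: Lattice: $\Lambda=A\mathbb Z^d$ with $A\in\mathbb R^{d\times d}$ invertible, $\mathrm{BZ}=A^{-T}[0,1)^d$. Each edge $e$ is oriented, with tail $e^-$ and head $e^+$, $e^-\neq e^+$; parallel edges are allowed. For a finite connected two-terminal weighted multigraph $G=(V,E,K,s,t)$ (kernels $K_e\in\ell^1(\Lambda)$, source $s$, sink $t$), the graph lattice sum is $$\mathcal Z_G(\boldsymbol k)=\sum_{\{\boldsymbol x_v\in\Lambda\}_{v\neq p}}e^{-2\pi i(\boldsymbol x_t-\boldsymbol x_s)\cdot\boldsymbol k}\prod_{e\in E}K_e(\boldsymbol x_{e^+}-\boldsymbol x_{e^-}),$$ where the sum runs over positions of all nodes except an arbitrary pinning node $p\in V$ whose position $\boldsymbol x_p\in\Lambda$ is held fixed (the value depends neither on $p$ nor on $\boldsymbol x_p$). Lattice Fourier transform of $f\in\ell^1(\Lambda)$: $(\mathcal F_\Lambda f)(\boldsymbol k)=\sum_{\boldsymbol x\in\Lambda}e^{-2\pi i\boldsymbol x\cdot\boldsymbol k}f(\boldsymbol x)$. Power-law kernel: $\mathcal K_\nu(\boldsymbol x)=|\boldsymbol x|^{-\nu}$ for $\boldsymbol x\ne\boldsymbol 0$ and $\mathcal K_\nu(\boldsymbol 0)=0$. Epstein zeta function: $Z_{\Lambda,\nu}(\boldsymbol k)=\sum_{\boldsymbol x\in\Lambda}e^{-2\pi i\boldsymbol x\cdot\boldsymbol k}\mathcal K_\nu(\boldsymbol x)$ for $\mathrm{Re}(\nu)>d$. *)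

theory Defs
  imports "Graph_Theory.Digraph_Component" "HOL-Analysis.Analysis"
begin

definition bravais_lattice :: "real^'d^'d \<Rightarrow> (real^'d) set" where
  "bravais_lattice A = {A *v z | z. \<forall>i. z $ i \<in> \<int>}"

definition brillouin_zone :: "real^'d^'d \<Rightarrow> (real^'d) set" where
  "brillouin_zone A = {matrix_inv (transpose A) *v u | u. \<forall>i. 0 \<le> u $ i \<and> u $ i < 1}"

definition ell1 :: "(real^'d) set \<Rightarrow> (real^'d \<Rightarrow> complex) set" where
  "ell1 L = {f. (\<lambda>x. norm (f x)) summable_on L}"

definition phase :: "real^'d \<Rightarrow> real^'d \<Rightarrow> complex" where
  "phase k x = exp (- 2 * of_real pi * \<i> * of_real (x \<bullet> k))"

definition lattice_fourier ::
    "(real^'d) set \<Rightarrow> (real^'d \<Rightarrow> complex) \<Rightarrow> real^'d \<Rightarrow> complex" where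
  "lattice_fourier L f k = (\<Sum>\<^sub>\<infinity>x\<in>L. phase k x * f x)"

definition power_kernel :: "complex \<Rightarrow> real^'d \<Rightarrow> complex" where
  "power_kernel \<nu> x = (if x = 0 then 0 else of_real (norm x) powr (- \<nu>))"

text \<open>Only meaningful for real part of \<open>\<nu>\<close> larger than the dimension; there is no analytic
  continuation here.\<close>

definition epstein_zeta :: "(real^'d) set \<Rightarrow> complex \<Rightarrow> real^'d \<Rightarrow> complex" where
  "epstein_zeta L \<nu> k = (\<Sum>\<^sub>\<infinity>x\<in>L. phase k x * power_kernel \<nu> x)"

text \<open>A multigraph is a \<open>pre_digraph\<close>: arcs have their own type, so parallel edges are allowed.
  The edge \<open>e\<close> is oriented from \<open>tail G e\<close> (written $e^-$) to \<open>head G e\<close> (written $e^+$).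
  The library predicate \<open>connected\<close> ignores the orientation. Equal terminals are allowed.\<close>

definition two_terminal_multigraph :: "('v, 'e) pre_digraph \<Rightarrow> 'v \<Rightarrow> 'v \<Rightarrow> bool" where
  "two_terminal_multigraph G s t \<longleftrightarrow>
     fin_digraph G \<and> loopfree_digraph G \<and> Digraph_Component.connected G \<and>
     s \<in> verts G \<and> t \<in> verts G"

text \<open>The sum over the positions of all nodes but the pinning node \<open>p\<close>, which sits at \<open>xp\<close>,
  is a sum over the extensional position maps \<open>x\<close> on the nodes with \<open>x p = xp\<close>.\<close>

definition graph_lattice_sum ::
    "(real^'d) set \<Rightarrow> ('v, 'e) pre_digraph \<Rightarrow> ('e \<Rightarrow> real^'d \<Rightarrow> complex) \<Rightarrow> 'v \<Rightarrow> 'v \<Rightarrow>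
     'v \<Rightarrow> real^'d \<Rightarrow> real^'d \<Rightarrow> complex" where
  "graph_lattice_sum L G K s t p xp k =
     (\<Sum>\<^sub>\<infinity>x\<in>{x \<in> verts G \<rightarrow>\<^sub>E L. x p = xp}.
        phase k (x t - x s) * (\<Prod>e\<in>arcs G. K e (x (head G e) - x (tail G e))))"

definition graph_zeta ::
    "(real^'d) set \<Rightarrow> ('v, 'e) pre_digraph \<Rightarrow> ('e \<Rightarrow> complex) \<Rightarrow> 'v \<Rightarrow> 'v \<Rightarrow>
     'v \<Rightarrow> real^'d \<Rightarrow> real^'d \<Rightarrow> complex" where
  "graph_zeta L G \<nu> s t p xp k = graph_lattice_sum L G (\<lambda>e. power_kernel (\<nu> e)) s t p xp k"

text \<open>For a loop-free graph on the nodes 1 and 2, the second case is exactly that of the edges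
  from 2 to 1.\<close>

definition oriented_kernel ::
    "(nat, 'e) pre_digraph \<Rightarrow> ('e \<Rightarrow> real^'d \<Rightarrow> complex) \<Rightarrow> 'e \<Rightarrow> real^'d \<Rightarrow> complex" where
  "oriented_kernel G K e =
     (if (tail G e, head G e) = (1, 2) then K e else (\<lambda>x. K e (- x)))"

end

theory Submission
  imports Defs
begin

text \<open>
  The summand depends on a configuration of the two nodes only through the displacement
  \<open>x 2 - x 1\<close>: for the phase this is clear, and an edge sees the displacement or its negative,
  according to its orientation. Since one node is pinned at a lattice point and the lattice is a
  group, the displacement runs through every lattice point exactly once
  (\<open>bij_betw_displacement\<close>). So the sum over configurations becomes the Fourier sum of
  the product of the oriented kernels (\<open>graph_lattice_sum_two_nodes\<close>), by a change of
  variables. For equal terminals the phase is trivial, just as it is at zero momentum.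

  Power-law kernels are even, so orientation does not matter for them, and they multiply by adding
  exponents (\<open>prod_power_kernel\<close>). This turns the Fourier sum into an Epstein zeta function.
\<close>

lemma bravais_lattice_add:
  assumes "x \<in> bravais_lattice A" "y \<in> bravais_lattice A"
  shows "x + y \<in> bravais_lattice A"
proof -
  obtain u v where "x = A *v u" "\<forall>i. u $ i \<in> \<int>" "y = A *v v" "\<forall>i. v $ i \<in> \<int>"
    using assms unfolding bravais_lattice_def by blast
  then have "x + y = A *v (u + v)" "\<forall>i. (u + v) $ i \<in> \<int>"
    by (simp_all add: matrix_vector_right_distrib)
  then show ?thesis
    unfolding bravais_lattice_def by blast
qed

lemma bravais_lattice_diff:
  assumes "x \<in> bravais_lattice A" "y \<in> bravais_lattice A"
  shows "x - y \<in> bravais_lattice A"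
proof -
  obtain u v where "x = A *v u" "\<forall>i. u $ i \<in> \<int>" "y = A *v v" "\<forall>i. v $ i \<in> \<int>"
    using assms unfolding bravais_lattice_def by blast
  then have "x - y = A *v (u - v)" "\<forall>i. (u - v) $ i \<in> \<int>"
    by (simp_all add: matrix_vector_mult_diff_distrib)
  then show ?thesis
    unfolding bravais_lattice_def by blast
qed

text \<open>
  The pinned position and the displacement determine the position of the other node. The inverse
  depends on which node is pinned: with the first at \<open>xp\<close>, the second is at \<open>xp + d\<close>; with
  the second at \<open>xp\<close>, the first is at \<open>xp - d\<close>. Closure under sums and differences keeps
  both in the lattice.
\<close>

lemma bij_betw_displacement:
  fixes L :: "'a::ab_group_add set" and a b p :: 'v
  assumes add: "\<And>x y. x \<in> L \<Longrightarrow> y \<in> L \<Longrightarrow> x + y \<in> L"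
    and diff: "\<And>x y. x \<in> L \<Longrightarrow> y \<in> L \<Longrightarrow> x - y \<in> L"
    and "a \<noteq> b" "p \<in> {a, b}" "xp \<in> L"
  shows "bij_betw (\<lambda>x. x b - x a) {x \<in> {a, b} \<rightarrow>\<^sub>E L. x p = xp} L"
proof -
  define conf where "conf d = (\<lambda>v. if v = p then xp else if v = b then xp + d
      else if v = a then xp - d else undefined)" for d
  have recover: "conf (x b - x a) = x" if "x \<in> {a, b} \<rightarrow>\<^sub>E L" "x p = xp" for x
  proof
    fix v
    have "x v = undefined" if "v \<notin> {a, b}"
      using PiE_arb[OF \<open>x \<in> {a, b} \<rightarrow>\<^sub>E L\<close> that] .
    moreover have "p = a \<or> p = b"
      using assms(4) by simp
    ultimately show "conf (x b - x a) v = x v"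
      unfolding conf_def \<open>x p = xp\<close>[symmetric] by (elim disjE) simp_all
  qed
  show ?thesis
  proof (rule bij_betw_byWitness[where f' = conf])
    show "\<forall>x\<in>{x \<in> {a, b} \<rightarrow>\<^sub>E L. x p = xp}. conf (x b - x a) = x"
      using recover by blast
    show "\<forall>d\<in>L. conf d b - conf d a = d"
      using assms(3,4) by (auto simp: conf_def)
    show "(\<lambda>x. x b - x a) ` {x \<in> {a, b} \<rightarrow>\<^sub>E L. x p = xp} \<subseteq> L"
      by (auto intro!: diff)
    show "conf ` L \<subseteq> {x \<in> {a, b} \<rightarrow>\<^sub>E L. x p = xp}"
      using assms(3-5) by (auto simp: conf_def PiE_iff extensional_def intro: add diff)
  qed
qed

text \<open>
  The momentum \<open>q\<close> lets one statement cover distinct terminals, where \<open>q = k\<close>, and equal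
  terminals, where \<open>q = 0\<close>.
\<close>

lemma graph_lattice_sum_two_nodes:
  fixes G :: "(nat, 'e) pre_digraph" and A :: "real^'d^'d"
  assumes L: "L = bravais_lattice A"
    and G: "loopfree_digraph G" "verts G = {1, 2}"
    and p: "p \<in> verts G" "xp \<in> L"
    and phase: "\<And>x. phase k (x t - x s) = phase q (x 2 - x 1)"
  shows "graph_lattice_sum L G K s t p xp k
    = lattice_fourier L (\<lambda>x. \<Prod>e\<in>arcs G. oriented_kernel G K e x) q"
proof -
  interpret loopfree_digraph G by (rule G(1))
  have kernel: "K e (x (head G e) - x (tail G e)) = oriented_kernel G K e (x 2 - x 1)"
    if "e \<in> arcs G" for e x
  proof -
    have "tail G e \<in> {1, 2}" "head G e \<in> {1, 2}" "tail G e \<noteq> head G e"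
      using that G(2) tail_in_verts head_in_verts no_loops by auto
    then show ?thesis
      by (auto simp: oriented_kernel_def)
  qed
  have bij: "bij_betw (\<lambda>x. x 2 - x 1) {x \<in> verts G \<rightarrow>\<^sub>E L. x p = xp} L"
    unfolding G(2)
    by (rule bij_betw_displacement)
      (use L G(2) p in \<open>auto intro: bravais_lattice_add bravais_lattice_diff\<close>)
  have "graph_lattice_sum L G K s t p xp k
      = (\<Sum>\<^sub>\<infinity>x\<in>{x \<in> verts G \<rightarrow>\<^sub>E L. x p = xp}.
           phase q (x 2 - x 1) * (\<Prod>e\<in>arcs G. oriented_kernel G K e (x 2 - x 1)))"
    unfolding graph_lattice_sum_def
    by (intro infsum_cong) (simp only: phase kernel cong: prod.cong)
  also have "\<dots> = lattice_fourier L (\<lambda>x. \<Prod>e\<in>arcs G. oriented_kernel G K e x) q"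
    unfolding lattice_fourier_def
    by (rule infsum_reindex_bij_betw[OF bij,
          of "\<lambda>d. phase q d * (\<Prod>e\<in>arcs G. oriented_kernel G K e d)"])
  finally show ?thesis .
qed

lemma oriented_power_kernel:
  "oriented_kernel G (\<lambda>e. power_kernel (\<nu> e)) e x = power_kernel (\<nu> e) x"
  by (simp add: oriented_kernel_def power_kernel_def)

text \<open>
  The product over no factors is \<open>1\<close>, whereas a power kernel vanishes at the origin; hence the
  index set must be nonempty.
\<close>

lemma prod_power_kernel:
  assumes "finite E" "E \<noteq> {}"
  shows "(\<Prod>e\<in>E. power_kernel (\<nu> e) x) = power_kernel (\<Sum>e\<in>E. \<nu> e) x"
  using assms
  by (induction E rule: finite_ne_induct) (simp_all add: power_kernel_def powr_add[symmetric])

theorem lemma4p4: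
  fixes A :: "real^'d^'d"
    and G :: "(nat, 'e) pre_digraph"
    and L :: "(real^'d) set"
    and p :: nat
    and xp k :: "real^'d"
  assumes "invertible A"
    and "L = bravais_lattice A"
    and "two_terminal_multigraph G 1 2"
    and "verts G = {1, 2}"
    and "arcs G \<noteq> {}"
    and "p \<in> verts G"
    and "xp \<in> L"
    and "k \<in> brillouin_zone A"
  shows
    "(\<forall>K. (\<forall>e\<in>arcs G. K e \<in> ell1 L) \<longrightarrow>
        graph_lattice_sum L G K 1 2 p xp k
          = lattice_fourier L (\<lambda>x. \<Prod>e\<in>arcs G. oriented_kernel G K e x) k
        \<and> (\<forall>r\<in>verts G. graph_lattice_sum L G K r r p xp k
          = lattice_fourier L (\<lambda>x. \<Prod>e\<in>arcs G. oriented_kernel G K e x) 0))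
     \<and> (\<forall>\<nu> :: 'e \<Rightarrow> complex. (\<forall>e\<in>arcs G. Re (\<nu> e) > real CARD('d)) \<longrightarrow>
        graph_zeta L G \<nu> 1 2 p xp k = epstein_zeta L (\<Sum>e\<in>arcs G. \<nu> e) k
        \<and> (\<forall>r\<in>verts G. graph_zeta L G \<nu> r r p xp k
          = epstein_zeta L (\<Sum>e\<in>arcs G. \<nu> e) 0))"
proof -
  have G: "loopfree_digraph G" and fin: "finite (arcs G)"
    using assms(3) by (auto simp: two_terminal_multigraph_def fin_digraph_def fin_digraph_axioms_def)
  have distinct: "graph_lattice_sum L G K 1 2 p xp k
      = lattice_fourier L (\<lambda>x. \<Prod>e\<in>arcs G. oriented_kernel G K e x) k" for K
    using assms G by (intro graph_lattice_sum_two_nodes) auto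
  have equal: "graph_lattice_sum L G K r r p xp k
      = lattice_fourier L (\<lambda>x. \<Prod>e\<in>arcs G. oriented_kernel G K e x) 0" for K r
    using assms G by (intro graph_lattice_sum_two_nodes) (auto simp: phase_def)
  have zeta: "lattice_fourier L
        (\<lambda>x. \<Prod>e\<in>arcs G. oriented_kernel G (\<lambda>e. power_kernel (\<nu> e)) e x) q
      = epstein_zeta L (\<Sum>e\<in>arcs G. \<nu> e) q" for \<nu> q
    by (simp add: lattice_fourier_def epstein_zeta_def oriented_power_kernel
        prod_power_kernel[OF fin assms(5)])
  show ?thesis
    by (simp add: graph_zeta_def distinct equal zeta del: One_nat_def)
qed

end
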